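(* Let $X$ be a nonempty set, $d$ a metric on $X$, $\varepsilon>0$ and $T:X\to X$ a map. Suppose that (i) $T$ is $(d,[d<\varepsilon];\lambda)$-contractive for some $\lambda\in(0,1)$; (ii) $X$ is $d$-complete and $T$ is $[d<\varepsilon]^\omega$-semi-progressive. Then $T$ is $[d<\varepsilon]^\omega$-global strongly Picard (modulo $(d,[d<\varepsilon]^\omega)$).
   Context: $\mathrm{Fix}(T)=\{x\in X: Tx=x\}$. $[d<\varepsilon]$ is the relation on $X$ given by $x[d<\varepsilon]y$ iff $d(x,y)<\varepsilon$. $x[d<\varepsilon]^\omega y$ iff there are $k\ge2$ and $z_1,\dots,z_k\in X$ with $z_1=x$, $z_k=y$ and $d(z_i,z_{i+1})<\varepsilon$ for $1\le i\le k-1$. $T$ is $(d,[d<\varepsilon];\lambda)$-contractive if $d(Tx,Ty)\le\lambda d(x,y)$ for all $x,y\in X$ with $d(x,y)<\varepsilon$. Put $X(T,[d<\varepsilon]^\omega)=\{x\in X: x[d<\varepsilon]^\omega Tx\}$; $T$ is $[d<\varepsilon]^\omega$-semi-progressive if this set is nonempty. $T$ is $[d<\varepsilon]^\omega$-global strongly Picard (modulo $(d,[d<\varepsilon]^\omega)$) if: (a) for each $x\in X(T,[d<\varepsilon]^\omega)$, the sequence $(T^nx)_{n\ge0}$ is $d$-convergent and its limit belongs to $\mathrm{Fix}(T)$; and (b) for all $z_1,z_2\in\mathrm{Fix}(T)$, $z_1[d<\varepsilon]^\omega z_2$ implies $z_1=z_2$. *)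

theory Defs
  imports "HOL-Analysis.Analysis"
begin

text \<open>
  The space is a carrier set \<open>X\<close> with a distance function \<open>d\<close>, as in the library locale
  \<open>Metric_space\<close>; relations on \<open>X\<close> are binary predicates that hold only between points of \<open>X\<close>.
\<close>

definition Fix :: "'a set \<Rightarrow> ('a \<Rightarrow> 'a) \<Rightarrow> 'a set" where
  "Fix X T = {x \<in> X. T x = x}"

definition near :: "'a set \<Rightarrow> ('a \<Rightarrow> 'a \<Rightarrow> real) \<Rightarrow> real \<Rightarrow> 'a \<Rightarrow> 'a \<Rightarrow> bool" where
  "near X d \<epsilon> x y \<longleftrightarrow> x \<in> X \<and> y \<in> X \<and> d x y < \<epsilon>"

text \<open>The relation \<open>R\<^sup>\<omega>\<close>; only the values \<open>z 1, \<dots>, z k\<close> matter.\<close>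

definition chain_rel :: "'a set \<Rightarrow> ('a \<Rightarrow> 'a \<Rightarrow> bool) \<Rightarrow> 'a \<Rightarrow> 'a \<Rightarrow> bool" where
  "chain_rel X R x y \<longleftrightarrow>
     (\<exists>k z. (2::nat) \<le> k \<and> (\<forall>i\<in>{1..k}. z i \<in> X) \<and> z 1 = x \<and> z k = y \<and>
            (\<forall>i\<in>{1..k - 1}. R (z i) (z (i + 1))))"

definition contractive ::
    "'a set \<Rightarrow> ('a \<Rightarrow> 'a \<Rightarrow> real) \<Rightarrow> ('a \<Rightarrow> 'a \<Rightarrow> bool) \<Rightarrow> real \<Rightarrow> ('a \<Rightarrow> 'a) \<Rightarrow> bool" where
  "contractive X d R lam T \<longleftrightarrow>
     (\<forall>x\<in>X. \<forall>y\<in>X. R x y \<longrightarrow> d (T x) (T y) \<le> lam * d x y)"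

definition progressive_set :: "'a set \<Rightarrow> ('a \<Rightarrow> 'a) \<Rightarrow> ('a \<Rightarrow> 'a \<Rightarrow> bool) \<Rightarrow> 'a set" where
  "progressive_set X T R = {x \<in> X. R x (T x)}"

definition semi_progressive :: "'a set \<Rightarrow> ('a \<Rightarrow> 'a \<Rightarrow> bool) \<Rightarrow> ('a \<Rightarrow> 'a) \<Rightarrow> bool" where
  "semi_progressive X R T \<longleftrightarrow> progressive_set X T R \<noteq> {}"

definition global_strongly_Picard ::
    "'a set \<Rightarrow> ('a \<Rightarrow> 'a \<Rightarrow> real) \<Rightarrow> ('a \<Rightarrow> 'a \<Rightarrow> bool) \<Rightarrow> ('a \<Rightarrow> 'a) \<Rightarrow> bool" where
  "global_strongly_Picard X d R T \<longleftrightarrow>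
     (\<forall>x\<in>progressive_set X T R.
        \<exists>l. limitin (Metric_space.mtopology X d) (\<lambda>n. (T ^^ n) x) l sequentially \<and> l \<in> Fix X T) \<and>
     (\<forall>z1\<in>Fix X T. \<forall>z2\<in>Fix X T. R z1 z2 \<longrightarrow> z1 = z2)"

end

theory Submission
  imports Defs
begin

text \<open>
  A local contraction shrinks each link of an \<open>\<epsilon>\<close>-chain geometrically: the images of two
  \<open>\<epsilon>\<close>-near points are again \<open>\<epsilon>\<close>-near, so the contraction inequality applies again at each
  iterate. Summing over the links, any two points joined by an \<open>\<epsilon>\<close>-chain satisfy
  \<open>d (T\<^sup>n x) (T\<^sup>n y) \<le> C * lam\<^sup>n\<close> for all \<open>n\<close>, where \<open>C\<close> is the length of the chain (lemma
  \<open>chain_orbits_geometric\<close>). Both parts of the theorem are read off from this estimate.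

  If \<open>x\<close> is joined to \<open>T x\<close>, the estimate with \<open>y = T x\<close> bounds the steps of the orbit of \<open>x\<close>
  by a geometric sequence. The orbit is therefore Cauchy and converges; since \<open>T\<close> is
  sequentially continuous (a convergent sequence is eventually \<open>\<epsilon>\<close>-near its limit, where \<open>T\<close>
  contracts), the limit is a fixed point.

  If two fixed points are joined by a chain, their distance equals that of their \<open>n\<close>-th iterates,
  which tends to zero.
\<close>

lemma chain_rel_imp_rtranclp:
  assumes "chain_rel X R x y"
  shows "R\<^sup>*\<^sup>* x y"
proof -
  obtain k :: nat and z where "2 \<le> k" "z 1 = x" "z k = y"
    and links: "\<And>i. i \<in> {1..k - 1} \<Longrightarrow> R (z i) (z (i + 1))"
    using assms unfolding chain_rel_def by blast
  have "R\<^sup>*\<^sup>* (z 1) (z j)" if "1 \<le> j" "j \<le> k" for j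
    using that
  proof (induction j rule: dec_induct)
    case (step j)
    then have "R (z j) (z (Suc j))"
      using links[of j] by simp
    with step show ?case
      by (meson Suc_leD rtranclp.rtrancl_into_rtrancl)
  qed simp
  from this[of k] show ?thesis
    using \<open>2 \<le> k\<close> \<open>z 1 = x\<close> \<open>z k = y\<close> by simp
qed

lemma funpow_closed:
  assumes "T \<in> X \<rightarrow> X" "x \<in> X"
  shows "(T ^^ n) x \<in> X"
  using assms by (induction n) auto

context Metric_space
begin

lemma near_orbits_geometric:
  assumes T: "T \<in> M \<rightarrow> M" and lam: "0 \<le> lam" "lam \<le> 1"
    and contr: "contractive M d (near M d \<epsilon>) lam T"
    and near: "near M d \<epsilon> x y"
  shows "d ((T ^^ n) x) ((T ^^ n) y) \<le> lam ^ n * d x y"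
proof (induction n)
  case (Suc n)
  have mem: "(T ^^ n) x \<in> M" "(T ^^ n) y \<in> M"
    using T near by (auto simp: near_def funpow_closed)
  have "lam ^ n * d x y \<le> 1 * d x y"
    using lam by (intro mult_right_mono) (auto simp: power_le_one)
  \<comment> \<open>The iterates stay \<open>\<epsilon>\<close>-near, so that the contraction inequality applies to them.\<close>
  then have "near M d \<epsilon> ((T ^^ n) x) ((T ^^ n) y)"
    using Suc mem near by (auto simp: near_def)
  then have "d ((T ^^ Suc n) x) ((T ^^ Suc n) y) \<le> lam * d ((T ^^ n) x) ((T ^^ n) y)"
    using contr mem by (auto simp: contractive_def)
  also have "\<dots> \<le> lam * (lam ^ n * d x y)"
    using Suc lam by (intro mult_left_mono) auto
  finally show ?case
    by (simp add: mult.assoc)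
qed simp

text \<open>
  The triangle inequality along the chain adds up the estimates for its links, which all decay
  with the same ratio.
\<close>

lemma chain_orbits_geometric:
  assumes T: "T \<in> M \<rightarrow> M" and lam: "0 \<le> lam" "lam \<le> 1"
    and contr: "contractive M d (near M d \<epsilon>) lam T"
    and chain: "(near M d \<epsilon>)\<^sup>*\<^sup>* x y" and x: "x \<in> M"
  obtains C where "\<And>n. d ((T ^^ n) x) ((T ^^ n) y) \<le> C * lam ^ n"
proof -
  from chain have "\<exists>C. \<forall>n. d ((T ^^ n) x) ((T ^^ n) y) \<le> C * lam ^ n"
  proof induction
    case base
    have "\<forall>n. d ((T ^^ n) x) ((T ^^ n) x) \<le> 0 * lam ^ n"
      using T x by (simp add: funpow_closed)
    then show ?case ..
  next
    case (step y z)
    then obtain C where C: "\<And>n. d ((T ^^ n) x) ((T ^^ n) y) \<le> C * lam ^ n"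
      by blast
    have "d ((T ^^ n) x) ((T ^^ n) z) \<le> (C + d y z) * lam ^ n" for n
    proof -
      have "d ((T ^^ n) x) ((T ^^ n) z)
            \<le> d ((T ^^ n) x) ((T ^^ n) y) + d ((T ^^ n) y) ((T ^^ n) z)"
        using T x step.hyps(2) by (intro triangle funpow_closed) (auto simp: near_def)
      also have "\<dots> \<le> C * lam ^ n + lam ^ n * d y z"
        by (intro add_mono C near_orbits_geometric[OF T lam contr step.hyps(2)])
      finally show ?thesis
        by (simp add: algebra_simps)
    qed
    then show ?case by blast
  qed
  with that show ?thesis by blast
qed

lemma MCauchy_geometric_steps:
  assumes mem: "\<And>n. s n \<in> M" and lam: "0 \<le> lam" "lam < 1"
    and steps: "\<And>n. d (s n) (s (Suc n)) \<le> C * lam ^ n"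
  shows "MCauchy s"
proof -
  define B where "B = C / (1 - lam)"
  have "0 \<le> C"
    using order_trans[OF nonneg steps[of 0]] by simp
  then have "0 \<le> B"
    using lam by (simp add: B_def)
  \<comment> \<open>The geometric sum in telescoped form: \<open>C * lam ^ n = B * lam ^ n - B * lam ^ Suc n\<close>.\<close>
  have C_eq: "C = B * (1 - lam)"
    using lam by (simp add: B_def)
  have telescoped: "d (s m) (s n) \<le> B * lam ^ m - B * lam ^ n" if "m \<le> n" for m n
    using that
  proof (induction n rule: dec_induct)
    case base
    show ?case using mem by simp
  next
    case (step n)
    have "d (s m) (s (Suc n)) \<le> d (s m) (s n) + d (s n) (s (Suc n))"
      by (intro triangle mem)
    also have "\<dots> \<le> (B * lam ^ m - B * lam ^ n) + B * (1 - lam) * lam ^ n"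
      using step.IH steps[of n] C_eq by simp
    finally show ?case
      by (simp add: algebra_simps)
  qed
  have tail: "d (s m) (s n) \<le> B * lam ^ N" if "N \<le> m" "m \<le> n" for m n N
  proof -
    have "d (s m) (s n) \<le> B * lam ^ m"
      using telescoped[OF \<open>m \<le> n\<close>] \<open>0 \<le> B\<close> lam by (smt (verit) mult_nonneg_nonneg zero_le_power)
    also have "\<dots> \<le> B * lam ^ N"
      using that \<open>0 \<le> B\<close> lam by (intro mult_left_mono power_decreasing) auto
    finally show ?thesis .
  qed
  have "(\<lambda>n. B * lam ^ n) \<longlonglongrightarrow> B * 0"
    using lam by (intro tendsto_mult_left LIMSEQ_realpow_zero) auto
  then have small: "\<exists>N. B * lam ^ N < e" if "0 < e" for e
    using order_tendstoD(2)[of _ "B * 0" sequentially e] that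
    by (auto simp: eventually_sequentially)
  have "\<exists>N. \<forall>m n. N \<le> m \<longrightarrow> N \<le> n \<longrightarrow> d (s m) (s n) < e" if "0 < e" for e
  proof -
    obtain N where "B * lam ^ N < e"
      using small[OF \<open>0 < e\<close>] by blast
    then have "d (s m) (s n) < e" if "N \<le> m" "N \<le> n" for m n
      using tail[of N m n] tail[of N n m] that commute[of "s m" "s n"]
      by (cases "m \<le> n") auto
    then show ?thesis by blast
  qed
  then show ?thesis
    using mem by (auto simp: MCauchy_def)
qed

text \<open>
  A convergent sequence is eventually within \<open>\<epsilon>\<close> of its limit, so a Lipschitz bound at
  scale \<open>\<epsilon>\<close> already gives sequential continuity.
\<close>

lemma locally_contractive_limitin:
  assumes T: "T \<in> M \<rightarrow> M" and "0 < \<epsilon>"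
    and contr: "contractive M d (near M d \<epsilon>) lam T"
    and lim: "limitin mtopology s l sequentially"
  shows "limitin mtopology (\<lambda>n. T (s n)) (T l) sequentially"
proof -
  have l: "l \<in> M" and s: "\<forall>\<^sub>F n in sequentially. s n \<in> M"
    and null: "(\<lambda>n. d (s n) l) \<longlonglongrightarrow> 0"
    using lim by (auto simp: limitin_metric_dist_null)
  have "\<forall>\<^sub>F n in sequentially. d (s n) l < \<epsilon>"
    using null \<open>0 < \<epsilon>\<close> by (rule order_tendstoD(2))
  with s have bound: "\<forall>\<^sub>F n in sequentially. d (T (s n)) (T l) \<le> lam * d (s n) l"
    by eventually_elim (use contr l in \<open>auto simp: contractive_def near_def\<close>)
  have "(\<lambda>n. lam * d (s n) l) \<longlonglongrightarrow> 0"
    using tendsto_mult_left[OF null, of lam] by simp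
  then have "(\<lambda>n. d (T (s n)) (T l)) \<longlonglongrightarrow> 0"
    by (intro tendsto_sandwich[OF _ bound tendsto_const]) auto
  moreover have "\<forall>\<^sub>F n in sequentially. T (s n) \<in> M"
    using s by eventually_elim (use T in auto)
  ultimately show ?thesis
    using l T by (auto simp: limitin_metric_dist_null)
qed

end

theorem theorem5p1:
  fixes X :: "'a set" and d :: "'a \<Rightarrow> 'a \<Rightarrow> real" and \<epsilon> :: real and T :: "'a \<Rightarrow> 'a"
  assumes "X \<noteq> {}"
    and "Metric_space X d"
    and "\<epsilon> > 0"
    and "T \<in> X \<rightarrow> X"
    and "\<exists>lam. 0 < lam \<and> lam < 1 \<and> contractive X d (near X d \<epsilon>) lam T"
    and "Metric_space.mcomplete X d"
    and "semi_progressive X (chain_rel X (near X d \<epsilon>)) T"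
  shows "global_strongly_Picard X d (chain_rel X (near X d \<epsilon>)) T"
proof -
  interpret Metric_space X d by fact
  note T = \<open>T \<in> X \<rightarrow> X\<close>
  obtain lam where lam: "0 \<le> lam" "lam < 1"
    and contr: "contractive X d (near X d \<epsilon>) lam T"
    using assms(5) by (metis less_imp_le)
  have chain_bound: "\<exists>C. \<forall>n. d ((T ^^ n) x) ((T ^^ n) y) \<le> C * lam ^ n"
    if "chain_rel X (near X d \<epsilon>) x y" "x \<in> X" for x y
    using chain_orbits_geometric[OF T _ _ contr chain_rel_imp_rtranclp[OF that(1)] that(2)] lam
    by (metis less_imp_le)
  have "\<exists>l. limitin mtopology (\<lambda>n. (T ^^ n) x) l sequentially \<and> l \<in> Fix X T"
    if "x \<in> progressive_set X T (chain_rel X (near X d \<epsilon>))" for x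
  proof -
    have x: "x \<in> X" and "chain_rel X (near X d \<epsilon>) x (T x)"
      using that by (auto simp: progressive_set_def)
    then obtain C where "\<And>n. d ((T ^^ n) x) ((T ^^ n) (T x)) \<le> C * lam ^ n"
      using chain_bound by blast
    then have "d ((T ^^ n) x) ((T ^^ Suc n) x) \<le> C * lam ^ n" for n
      by (simp only: funpow_Suc_right comp_apply)
    then have "MCauchy (\<lambda>n. (T ^^ n) x)"
      by (intro MCauchy_geometric_steps[OF _ lam] funpow_closed[OF T x])
    then obtain l where l: "limitin mtopology (\<lambda>n. (T ^^ n) x) l sequentially"
      using \<open>mcomplete\<close> by (auto simp: mcomplete_def)
    have "limitin mtopology (\<lambda>n. (T ^^ Suc n) x) (T l) sequentially"
      using locally_contractive_limitin[OF T \<open>\<epsilon> > 0\<close> contr l] by simp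
    moreover have "limitin mtopology (\<lambda>n. (T ^^ Suc n) x) l sequentially"
      using limitin_subsequence[OF _ l, of Suc] by (simp add: strict_mono_def comp_def)
    ultimately have "T l = l"
      by (rule limitin_metric_unique) simp
    moreover have "l \<in> X"
      using l by (rule limitin_mspace)
    ultimately show ?thesis
      using l by (auto simp: Fix_def)
  qed
  moreover have "z1 = z2"
    if "z1 \<in> Fix X T" "z2 \<in> Fix X T" and chain: "chain_rel X (near X d \<epsilon>) z1 z2" for z1 z2
  proof -
    have z: "z1 \<in> X" "z2 \<in> X" "T z1 = z1" "T z2 = z2"
      using that by (auto simp: Fix_def)
    then have iter: "(T ^^ n) z1 = z1" "(T ^^ n) z2 = z2" for n
      by (induction n) auto
    obtain C where C: "\<And>n. d z1 z2 \<le> C * lam ^ n"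
      using chain_bound[OF chain z(1)] by (auto simp: iter)
    have "(\<lambda>n. C * lam ^ n) \<longlonglongrightarrow> C * 0"
      using lam by (intro tendsto_mult_left LIMSEQ_realpow_zero) auto
    then have "d z1 z2 \<le> C * 0"
      by (rule LIMSEQ_le_const) (use C in blast)
    then show ?thesis
      using z nonneg[of z1 z2] by (simp flip: zero)
  qed
  ultimately show ?thesis
    by (auto simp: global_strongly_Picard_def)
qed

end
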